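(* Let $\mathcal{G}_{6,7}$ be the real Lie algebra with basis $x_1,\dots,x_6$ and nonzero brackets $[x_1,x_2]=x_4$, $[x_1,x_3]=x_5$, $[x_1,x_4]=x_6$, $[x_2,x_3]=-x_6$. For real $\alpha\neq 0,1$ let $$J_\alpha=\mathrm{diag}\left(\begin{pmatrix}0&1\\-1&0\end{pmatrix},\begin{pmatrix}0&\alpha\\-\frac1\alpha&0\end{pmatrix},\begin{pmatrix}0&-\frac{\alpha}{\alpha-1}\\\frac{\alpha-1}{\alpha}&0\end{pmatrix}\right).$$ Then every complex structure on $\mathcal{G}_{6,7}$ is equivalent to $J_\alpha$ for some $\alpha\in\mathbb{R}\setminus\{0,1\}$, and $J_\alpha$, $J_{\alpha'}$ are not equivalent for $\alpha\ne\alpha'$. The set $\mathfrak{X}_{6,7}$ of all complex structures on $\mathcal{G}_{6,7}$ is a submanifold of dimension 10 of $\mathbb{R}^{36}$, and it is the disjoint union of the $\mathrm{Aut}(\mathcal{G}_{6,7})$-orbits of the $J_\alpha$, $\alpha\in\mathbb{R}\setminus\{0,1\}$.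
   Context: Brackets of basis vectors not listed (and not obtained by antisymmetry) are zero. A complex structure on a real Lie algebra $\mathfrak{g}$ is a linear map $J:\mathfrak{g}\to\mathfrak{g}$ with $J^2=-1$ and $[JX,JY]-[X,Y]-J[JX,Y]-J[X,JY]=0$ for all $X,Y\in\mathfrak{g}$. $J$ is identified with its $6\times 6$ matrix $(\xi^k_j)$ ($k$ the row index, $j$ the column index) in the basis $(x_j)$, i.e. $Jx_j=\sum_k\xi^k_j x_k$; so the set of complex structures is a subset of $\mathbb{R}^{36}$. "Submanifold" means smooth ($C^\infty$) submanifold. $\mathrm{Aut}(\mathfrak{g})$ acts on complex structures by $J\mapsto\Phi^{-1}J\Phi$, and two complex structures are equivalent if they lie in the same orbit. $\mathrm{diag}$ denotes a block-diagonal matrix. *)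

theory Defs
  imports "HOL-Analysis.Analysis"
begin

section \<open>Lie algebras and complex structures\<close>

definition lie_bracket :: "('a::real_vector \<Rightarrow> 'a \<Rightarrow> 'a) \<Rightarrow> bool"
  where "lie_bracket br \<longleftrightarrow>
    bilinear br \<and> (\<forall>x. br x x = 0) \<and>
    (\<forall>x y z. br x (br y z) + br y (br z x) + br z (br x y) = 0)"

text \<open>Linear maps are identified with their matrices in the standard basis: column \<open>j\<close> of \<open>A\<close> is
  the image \<open>A *v axis j 1\<close>, and the entry in row \<open>k\<close> and column \<open>j\<close> is \<open>A $ k $ j\<close>.\<close>

definition complex_structures ::
    "(real^'n \<Rightarrow> real^'n \<Rightarrow> real^'n) \<Rightarrow> (real^'n^'n) set"
  where "complex_structures br =
    {J. J ** J = - mat 1 \<and>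
        (\<forall>X Y. br (J *v X) (J *v Y) - br X Y - J *v br (J *v X) Y - J *v br X (J *v Y) = 0)}"

definition lie_automorphisms ::
    "(real^'n \<Rightarrow> real^'n \<Rightarrow> real^'n) \<Rightarrow> (real^'n^'n) set"
  where "lie_automorphisms br =
    {\<Phi>. invertible \<Phi> \<and> (\<forall>X Y. \<Phi> *v br X Y = br (\<Phi> *v X) (\<Phi> *v Y))}"

definition aut_orbit ::
    "(real^'n \<Rightarrow> real^'n \<Rightarrow> real^'n) \<Rightarrow> real^'n^'n \<Rightarrow> (real^'n^'n) set"
  where "aut_orbit br J = (\<lambda>\<Phi>. matrix_inv \<Phi> ** J ** \<Phi>) ` lie_automorphisms br"

definition equivalent_structures ::
    "(real^'n \<Rightarrow> real^'n \<Rightarrow> real^'n) \<Rightarrow> real^'n^'n \<Rightarrow> real^'n^'n \<Rightarrow> bool"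
  where "equivalent_structures br J J' \<longleftrightarrow>
    (\<exists>K\<in>complex_structures br. J \<in> aut_orbit br K \<and> J' \<in> aut_orbit br K)"


section \<open>Smooth submanifolds of Euclidean spaces\<close>

text \<open>\<open>Ck_on k f U\<close> says that \<open>f\<close> is \<open>k\<close> times continuously differentiable; it is meant for open
  \<open>U\<close>, the derivatives being those at interior points.\<close>

primrec Ck_on ::
    "nat \<Rightarrow> ('a::real_normed_vector \<Rightarrow> 'b::real_normed_vector) \<Rightarrow> 'a set \<Rightarrow> bool"
  where
    "Ck_on 0 f U \<longleftrightarrow> continuous_on U f"
  | "Ck_on (Suc k) f U \<longleftrightarrow>
       (\<forall>x\<in>U. f differentiable (at x)) \<and>
       (\<forall>v. Ck_on k (\<lambda>x. frechet_derivative f (at x) v) U)"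

definition smooth_map_on ::
    "'a set \<Rightarrow> ('a::real_normed_vector \<Rightarrow> 'b::real_normed_vector) \<Rightarrow> bool"
  where "smooth_map_on U f \<longleftrightarrow> (\<forall>k. Ck_on k f U)"

definition diffeomorphism_between ::
    "'a::real_normed_vector set \<Rightarrow> 'b::real_normed_vector set \<Rightarrow> ('a \<Rightarrow> 'b) \<Rightarrow> ('b \<Rightarrow> 'a) \<Rightarrow> bool"
  where "diffeomorphism_between U V \<phi> \<psi> \<longleftrightarrow>
    open U \<and> open V \<and> homeomorphism U V \<phi> \<psi> \<and> smooth_map_on U \<phi> \<and> smooth_map_on V \<psi>"

text \<open>Embedded submanifolds, defined by slice charts.\<close>

definition smooth_submanifold :: "nat \<Rightarrow> 'a::euclidean_space set \<Rightarrow> bool"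
  where "smooth_submanifold d S \<longleftrightarrow>
    (\<forall>p\<in>S. \<exists>U V (\<phi> :: 'a \<Rightarrow> 'a) \<psi> L.
       p \<in> U \<and> diffeomorphism_between U V \<phi> \<psi> \<and>
       subspace L \<and> dim L = d \<and> \<phi> ` (S \<inter> U) = L \<inter> V)"


section \<open>The Lie algebra $\mathcal{G}_{6,7}$\<close>

text \<open>In the index type \<open>6\<close> the numeral \<open>6\<close> is \<open>0\<close>, so \<open>1, ..., 6\<close> are exactly its six elements.\<close>

abbreviation x67 :: "6 \<Rightarrow> real^6"
  where "x67 i \<equiv> axis i 1"

definition bracket67 :: "real^6 \<Rightarrow> real^6 \<Rightarrow> real^6"
  where "bracket67 X Y =
    (X$1 * Y$2 - X$2 * Y$1) *\<^sub>R x67 4 +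
    (X$1 * Y$3 - X$3 * Y$1) *\<^sub>R x67 5 +
    (X$1 * Y$4 - X$4 * Y$1) *\<^sub>R x67 6 -
    (X$2 * Y$3 - X$3 * Y$2) *\<^sub>R x67 6"

definition J67 :: "real \<Rightarrow> real^6^6"
  where "J67 \<alpha> = vector
    [vector [ 0, 1,      0, 0,                 0, 0],
     vector [-1, 0,      0, 0,                 0, 0],
     vector [ 0, 0,      0, \<alpha>,                 0, 0],
     vector [ 0, 0, -1 / \<alpha>, 0,                 0, 0],
     vector [ 0, 0,      0, 0,                 0, -(\<alpha> / (\<alpha> - 1))],
     vector [ 0, 0,      0, 0, (\<alpha> - 1) / \<alpha>, 0]]"


subsection \<open>Basic facts\<close>

lemma UNIV_6: "(UNIV :: 6 set) = {1, 2, 3, 4, 5, 6}"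
proof -
  have "card {1, 2, 3, 4, 5, 6 :: 6} = 6" by simp
  then have "{1, 2, 3, 4, 5, 6 :: 6} = UNIV"
    by (intro card_subset_eq) auto
  then show ?thesis by simp
qed

lemma forall_6: "(\<forall>i::6. P i) \<longleftrightarrow> P 1 \<and> P 2 \<and> P 3 \<and> P 4 \<and> P 5 \<and> P 6"
proof -
  have "(\<forall>i::6. P i) \<longleftrightarrow> (\<forall>i\<in>{1, 2, 3, 4, 5, 6}. P i)"
    unfolding UNIV_6[symmetric] by simp
  then show ?thesis by simp
qed

lemma sum_6: "sum f (UNIV :: 6 set) = f 1 + f 2 + f 3 + f 4 + f 5 + f 6"
  unfolding UNIV_6 by (simp add: add.assoc)

lemma vector_6 [simp]:
  "(vector [a, b, c, d, e, f] :: 'a::zero^6) $ 1 = a"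
  "(vector [a, b, c, d, e, f] :: 'a::zero^6) $ 2 = b"
  "(vector [a, b, c, d, e, f] :: 'a::zero^6) $ 3 = c"
  "(vector [a, b, c, d, e, f] :: 'a::zero^6) $ 4 = d"
  "(vector [a, b, c, d, e, f] :: 'a::zero^6) $ 5 = e"
  "(vector [a, b, c, d, e, f] :: 'a::zero^6) $ 6 = f"
  by (simp_all add: vector_def)

lemma bracket67_components:
  "bracket67 X Y $ 1 = 0" "bracket67 X Y $ 2 = 0" "bracket67 X Y $ 3 = 0"
  "bracket67 X Y $ 4 = X$1 * Y$2 - X$2 * Y$1"
  "bracket67 X Y $ 5 = X$1 * Y$3 - X$3 * Y$1"
  "bracket67 X Y $ 6 = X$1 * Y$4 - X$4 * Y$1 - (X$2 * Y$3 - X$3 * Y$2)"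
  by (simp_all add: bracket67_def axis_def)

lemma bracket67_basis:
  "bracket67 (x67 1) (x67 2) = x67 4"
  "bracket67 (x67 1) (x67 3) = x67 5"
  "bracket67 (x67 1) (x67 4) = x67 6"
  "bracket67 (x67 2) (x67 3) = - x67 6"
  by (simp_all add: bracket67_def axis_def vec_eq_iff)

lemma bracket67_basis_zero:
  "bracket67 (x67 1) (x67 5) = 0" "bracket67 (x67 1) (x67 6) = 0"
  "bracket67 (x67 2) (x67 4) = 0" "bracket67 (x67 2) (x67 5) = 0" "bracket67 (x67 2) (x67 6) = 0"
  "bracket67 (x67 3) (x67 4) = 0" "bracket67 (x67 3) (x67 5) = 0" "bracket67 (x67 3) (x67 6) = 0"
  "bracket67 (x67 4) (x67 5) = 0" "bracket67 (x67 4) (x67 6) = 0" "bracket67 (x67 5) (x67 6) = 0"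
  by (simp_all add: bracket67_def axis_def)

lemma lie_bracket_bracket67: "lie_bracket bracket67"
  unfolding lie_bracket_def bilinear_def
  by (auto intro!: linearI simp: vec_eq_iff forall_6 bracket67_components algebra_simps)

lemma J67_basis:
  "J67 \<alpha> *v x67 1 = - x67 2"
  "J67 \<alpha> *v x67 2 = x67 1"
  "J67 \<alpha> *v x67 3 = (-1 / \<alpha>) *\<^sub>R x67 4"
  "J67 \<alpha> *v x67 4 = \<alpha> *\<^sub>R x67 3"
  "J67 \<alpha> *v x67 5 = ((\<alpha> - 1) / \<alpha>) *\<^sub>R x67 6"
  "J67 \<alpha> *v x67 6 = (-(\<alpha> / (\<alpha> - 1))) *\<^sub>R x67 5"
  by (simp_all add: J67_def matrix_vector_mult_def sum_6 vec_eq_iff forall_6 axis_def)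

end

theory Submission
  imports Defs
begin

text \<open>Let \<open>J\<close> be a complex structure. For central \<open>Z\<close> the integrability condition says that \<open>ad (J Z)\<close>
  commutes with \<open>J\<close>; since the ranks of its powers are then even, \<open>J\<close> preserves the flag
  \<open>span {x5, x6}\<close>, \<open>span {x3, x4, x5, x6}\<close>. Given this, integrability reduces to the vanishing of the
  Nijenhuis tensor at \<open>(x2, x4)\<close>, which determines \<open>J x6\<close> rationally from the entries
  \<open>p = J12\<close>, \<open>r = J22\<close>, \<open>q = J34\<close>, \<open>s = J44\<close> and forces \<open>p \<noteq> q\<close>.
  So \<open>J\<close> is a rational function of the six coordinates of \<open>J x2\<close> and the four coordinates of \<open>J x4\<close>:
  the set of complex structures is a graph over an open subset of a 10-dimensional space. The
  automorphism sending \<open>x1, x2\<close> to \<open>J x2, x2\<close> transports \<open>J67 (q / p)\<close> to \<open>J\<close>, and \<open>q / p\<close> is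
  invariant under automorphisms.\<close>

section \<open>Smooth maps\<close>

text \<open>Agreement on an open set is agreement near each of its points, so the Frechet
  derivatives on \<open>U\<close> coincide as well and the induction passes to them.\<close>

lemma Ck_on_cong:
  assumes "open U" "\<And>x. x \<in> U \<Longrightarrow> f x = g x" "Ck_on k f U"
  shows "Ck_on k g U"
  using assms(2,3)
proof (induction k arbitrary: f g)
  case 0
  then show ?case by (auto cong: continuous_on_cong)
next
  case (Suc k)
  have deriv: "(g has_derivative frechet_derivative f (at x)) (at x)" if "x \<in> U" for x
  proof (rule has_derivative_transform_within_open[OF _ assms(1) that])
    show "(f has_derivative frechet_derivative f (at x)) (at x)"
      using Suc.prems(2) that by (simp add: frechet_derivative_works[symmetric])
  qed (rule Suc.prems(1))
  have "frechet_derivative g (at x) = frechet_derivative f (at x)" if "x \<in> U" for x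
    using frechet_derivative_at[OF deriv[OF that]] by simp
  then have "Ck_on k (\<lambda>x. frechet_derivative g (at x) v) U" for v
    using Suc.prems(2) by - (rule Suc.IH[of "\<lambda>x. frechet_derivative f (at x) v"], simp_all)
  with deriv show ?case
    by (auto simp: differentiable_def)
qed

text \<open>Derivatives are unique, so any explicit formula \<open>f'\<close> can replace
  \<open>frechet_derivative\<close> in the recursion. The closure properties below then reduce to
  the usual differentiation rules.\<close>

lemma Ck_on_SucI:
  assumes "open U" "\<And>x. x \<in> U \<Longrightarrow> (f has_derivative f' x) (at x)"
    "\<And>v. Ck_on k (\<lambda>x. f' x v) U"
  shows "Ck_on (Suc k) f U"
proof -
  have "frechet_derivative f (at x) = f' x" if "x \<in> U" for x
    using frechet_derivative_at[OF assms(2)[OF that]] by simp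
  then have "Ck_on k (\<lambda>x. frechet_derivative f (at x) v) U" for v
    using assms(3) by - (rule Ck_on_cong[OF assms(1), of "\<lambda>x. f' x v"], simp_all)
  with assms(2) show ?thesis
    by (auto simp: differentiable_def)
qed

lemma Ck_on_SucD:
  assumes "Ck_on (Suc k) f U"
  shows "x \<in> U \<Longrightarrow> (f has_derivative frechet_derivative f (at x)) (at x)"
    and "Ck_on k (\<lambda>x. frechet_derivative f (at x) v) U"
  using assms by (simp_all add: frechet_derivative_works[symmetric])

text \<open>\<open>Ck_on\<close> asks for continuity only at level 0, where differentiability
  supplies it; at higher levels the induction hypothesis applies to the derivatives.\<close>

lemma Ck_on_mono: "Ck_on (Suc k) f U \<Longrightarrow> Ck_on k f U"
proof (induction k arbitrary: f)
  case 0
  then show ?case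
    by (auto intro!: continuous_at_imp_continuous_on differentiable_imp_continuous_within)
qed auto

lemma Ck_on_const: "Ck_on k (\<lambda>x. c) U"
proof (induction k arbitrary: c)
  case (Suc k)
  then show ?case by (simp add: frechet_derivative_const)
qed simp

lemma Ck_on_bounded_linear:
  assumes "bounded_linear h" "open U"
  shows "Ck_on k h U"
proof (cases k)
  case 0
  then show ?thesis using assms by (simp add: linear_continuous_on)
next
  case (Suc n)
  show ?thesis unfolding Suc
    by (rule Ck_on_SucI[where f'="\<lambda>_. h"])
      (auto simp: assms Ck_on_const intro: bounded_linear_imp_has_derivative)
qed

lemma Ck_on_compose_linear:
  assumes "bounded_linear h" "open U" "Ck_on k f U"
  shows "Ck_on k (\<lambda>x. h (f x)) U"
  using assms(3)
proof (induction k arbitrary: f)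
  case 0
  then show ?case using assms by (auto intro: bounded_linear.continuous_on)
next
  case (Suc k)
  show ?case
    by (rule Ck_on_SucI[OF assms(2), where f'="\<lambda>x v. h (frechet_derivative f (at x) v)"])
      (rule bounded_linear.has_derivative[OF assms(1)] Suc.IH Ck_on_SucD Suc.prems | assumption)+
qed

lemma Ck_on_add:
  assumes "open U" "Ck_on k f U" "Ck_on k g U"
  shows "Ck_on k (\<lambda>x. f x + g x) U"
  using assms(2,3)
proof (induction k arbitrary: f g)
  case 0
  then show ?case by (auto intro: continuous_intros)
next
  case (Suc k)
  show ?case
    by (rule Ck_on_SucI[OF assms(1), where
          f'="\<lambda>x v. frechet_derivative f (at x) v + frechet_derivative g (at x) v"])
      (use Suc in \<open>auto intro!: has_derivative_add Suc.IH dest: Ck_on_SucD(1)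
          simp del: Ck_on.simps intro: Ck_on_SucD(2)\<close>)
qed

text \<open>By the product rule both summands of the derivative are again values of \<open>h\<close>
  on one of the maps and a derivative of the other, so the induction hypothesis covers them once
  \<open>f\<close> and \<open>g\<close> are lowered by one level of differentiability.\<close>

lemma Ck_on_bilinear:
  assumes "bounded_bilinear h" "open U" "Ck_on k f U" "Ck_on k g U"
  shows "Ck_on k (\<lambda>x. h (f x) (g x)) U"
  using assms(3,4)
proof (induction k arbitrary: f g)
  case 0
  then show ?case using assms by (auto intro: bounded_bilinear.continuous_on)
next
  case (Suc k)
  show ?case
    by (rule Ck_on_SucI[OF assms(2), where
          f'="\<lambda>x v. h (f x) (frechet_derivative g (at x) v) + h (frechet_derivative f (at x) v) (g x)"])
      (use Suc in \<open>auto intro!: bounded_bilinear.FDERIV[OF assms(1)] Ck_on_add[OF assms(2)] Suc.IH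
          dest: Ck_on_SucD(1) Ck_on_mono simp del: Ck_on.simps intro: Ck_on_SucD(2)\<close>)
qed

text \<open>The derivative of \<open>1/f\<close> is a product of two copies of \<open>1/f\<close>,
  which are of class \<open>k\<close> by the induction hypothesis, and the derivative of
  \<open>f\<close>.\<close>

lemma Ck_on_inverse:
  fixes f :: "'a::real_normed_vector \<Rightarrow> real"
  assumes "open U" "\<And>x. x \<in> U \<Longrightarrow> f x \<noteq> 0" "Ck_on k f U"
  shows "Ck_on k (\<lambda>x. inverse (f x)) U"
  using assms(3)
proof (induction k)
  case 0
  then show ?case using assms(2) by (auto intro: continuous_intros)
next
  case (Suc k)
  have inv: "Ck_on k (\<lambda>x. inverse (f x)) U"
    using Suc by (auto dest: Ck_on_mono simp del: Ck_on.simps)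
  have "Ck_on k (\<lambda>x. - (inverse (f x) * frechet_derivative f (at x) v * inverse (f x))) U" for v
    by (intro Ck_on_compose_linear[OF bounded_linear_minus[OF bounded_linear_ident]]
        Ck_on_bilinear[OF bounded_bilinear_mult] inv assms(1) Ck_on_SucD(2) Suc.prems)
  then show ?case
    by (intro Ck_on_SucI[OF assms(1), where
          f'="\<lambda>x v. - (inverse (f x) * frechet_derivative f (at x) v * inverse (f x))"])
      (use Suc.prems assms(2) in \<open>auto intro!: Deriv.has_derivative_inverse dest: Ck_on_SucD(1)
          simp del: Ck_on.simps\<close>)
qed

section \<open>Closure properties of smooth maps\<close>

lemma smooth_map_on_const: "smooth_map_on U (\<lambda>x. c)"
  by (simp add: smooth_map_on_def Ck_on_const)

lemma smooth_map_on_bounded_linear: "open U \<Longrightarrow> bounded_linear h \<Longrightarrow> smooth_map_on U h"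
  by (simp add: smooth_map_on_def Ck_on_bounded_linear)

lemma smooth_map_on_compose_linear:
  "open U \<Longrightarrow> bounded_linear h \<Longrightarrow> smooth_map_on U f \<Longrightarrow> smooth_map_on U (\<lambda>x. h (f x))"
  by (simp add: smooth_map_on_def Ck_on_compose_linear)

lemma smooth_map_on_add:
  "open U \<Longrightarrow> smooth_map_on U f \<Longrightarrow> smooth_map_on U g \<Longrightarrow> smooth_map_on U (\<lambda>x. f x + g x)"
  by (simp add: smooth_map_on_def Ck_on_add)

lemma smooth_map_on_minus:
  "open U \<Longrightarrow> smooth_map_on U f \<Longrightarrow> smooth_map_on U (\<lambda>x. - f x)"
  by (rule smooth_map_on_compose_linear[OF _ bounded_linear_minus[OF bounded_linear_ident]])

lemma smooth_map_on_diff: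
  "open U \<Longrightarrow> smooth_map_on U f \<Longrightarrow> smooth_map_on U g \<Longrightarrow> smooth_map_on U (\<lambda>x. f x - g x)"
  using smooth_map_on_add[OF _ _ smooth_map_on_minus, of U f g] by simp

lemma smooth_map_on_sum:
  "open U \<Longrightarrow> (\<And>i. i \<in> I \<Longrightarrow> smooth_map_on U (f i)) \<Longrightarrow> smooth_map_on U (\<lambda>x. \<Sum>i\<in>I. f i x)"
  by (induction I rule: infinite_finite_induct)
    (auto intro: smooth_map_on_const smooth_map_on_add)

lemma smooth_map_on_mult:
  fixes f g :: "'a::real_normed_vector \<Rightarrow> real"
  shows "open U \<Longrightarrow> smooth_map_on U f \<Longrightarrow> smooth_map_on U g \<Longrightarrow> smooth_map_on U (\<lambda>x. f x * g x)"
  by (simp add: smooth_map_on_def Ck_on_bilinear[OF bounded_bilinear_mult])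

lemma smooth_map_on_scaleR:
  "open U \<Longrightarrow> smooth_map_on U f \<Longrightarrow> smooth_map_on U g \<Longrightarrow> smooth_map_on U (\<lambda>x. f x *\<^sub>R g x)"
  by (simp add: smooth_map_on_def Ck_on_bilinear[OF bounded_bilinear_scaleR])

lemma smooth_map_on_divide:
  fixes f g :: "'a::real_normed_vector \<Rightarrow> real"
  shows "open U \<Longrightarrow> smooth_map_on U f \<Longrightarrow> smooth_map_on U g \<Longrightarrow> (\<And>x. x \<in> U \<Longrightarrow> g x \<noteq> 0) \<Longrightarrow>
    smooth_map_on U (\<lambda>x. f x / g x)"
  unfolding divide_inverse
  by (intro smooth_map_on_mult) (auto simp: smooth_map_on_def Ck_on_inverse)

lemma smooth_map_on_vec:
  fixes f :: "'a::real_normed_vector \<Rightarrow> 'b::euclidean_space^'n"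
  assumes "open U" "\<And>i. smooth_map_on U (\<lambda>x. f x $ i)"
  shows "smooth_map_on U f"
proof -
  have "(\<lambda>x. \<Sum>i\<in>UNIV. axis i (f x $ i)) = f"
    by (simp add: fun_eq_iff vec_eq_iff axis_def)
  moreover have lin: "bounded_linear (axis i :: 'b \<Rightarrow> 'b^'n)" for i
    by (auto intro!: linearI simp: linear_conv_bounded_linear[symmetric] vec_eq_iff axis_def)
  moreover have "smooth_map_on U (\<lambda>x. \<Sum>i\<in>UNIV. axis i (f x $ i))"
    by (intro smooth_map_on_sum smooth_map_on_compose_linear[OF _ lin] assms)
  ultimately show ?thesis by simp
qed

section \<open>Orbits of complex structures\<close>

lemma matrix_eq_axisI:
  fixes A B :: "real^'n^'m"
  assumes "\<And>j. A *v axis j 1 = B *v axis j 1"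
  shows "A = B"
  using assms by (simp add: matrix_vector_mult_basis column_def vec_eq_iff)

lemma minus_mat_1_mult_vec: "(- mat 1 :: real^'n^'n) *v X = - X"
  using matrix_vector_mult_diff_rdistrib[of 0 "mat 1" X] by simp

lemma square_minus_one_iff:
  fixes J :: "real^'n^'n"
  shows "J ** J = - mat 1 \<longleftrightarrow> (\<forall>X. J *v (J *v X) = - X)"
  by (simp add: matrix_eq matrix_vector_mul_assoc minus_mat_1_mult_vec)

lemma
  assumes "invertible A"
  shows matrix_inv_left: "matrix_inv A ** A = mat 1"
    and matrix_inv_right: "A ** matrix_inv A = mat 1"
  using assms someI_ex[of "\<lambda>B. A ** B = mat 1 \<and> B ** A = mat 1"]
  unfolding invertible_def matrix_inv_def by blast+

lemma lie_automorphism_inverse: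
  assumes "\<Phi> \<in> lie_automorphisms br"
  shows "matrix_inv \<Phi> \<in> lie_automorphisms br"
proof -
  have inv: "invertible \<Phi>" and hom: "\<Phi> *v br X Y = br (\<Phi> *v X) (\<Phi> *v Y)" for X Y
    using assms by (auto simp: lie_automorphisms_def)
  note left = matrix_inv_left[OF inv] and right = matrix_inv_right[OF inv]
  have "matrix_inv \<Phi> *v br X Y = br (matrix_inv \<Phi> *v X) (matrix_inv \<Phi> *v Y)" for X Y
  proof -
    have "matrix_inv \<Phi> *v br X Y
        = matrix_inv \<Phi> *v (\<Phi> *v br (matrix_inv \<Phi> *v X) (matrix_inv \<Phi> *v Y))"
      unfolding hom by (simp add: matrix_vector_mul_assoc right)
    then show ?thesis by (simp add: matrix_vector_mul_assoc left)
  qed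
  moreover have "invertible (matrix_inv \<Phi>)"
    using left right unfolding invertible_def by blast
  ultimately show ?thesis by (auto simp: lie_automorphisms_def)
qed

lemma lie_automorphism_mult:
  assumes "\<Phi> \<in> lie_automorphisms br" "\<Psi> \<in> lie_automorphisms br"
  shows "\<Phi> ** \<Psi> \<in> lie_automorphisms br"
  using assms by (auto simp: lie_automorphisms_def invertible_mult matrix_vector_mul_assoc[symmetric])

text \<open>The intertwining form clears the inverse; membership in an orbit is used in this form
  from here on.\<close>

lemma in_aut_orbit_iff:
  "J \<in> aut_orbit br K \<longleftrightarrow> (\<exists>\<Phi>\<in>lie_automorphisms br. \<Phi> ** J = K ** \<Phi>)"
proof -
  have "J = matrix_inv \<Phi> ** K ** \<Phi> \<longleftrightarrow> \<Phi> ** J = K ** \<Phi>" if "\<Phi> \<in> lie_automorphisms br" for \<Phi>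
  proof -
    have inv: "invertible \<Phi>" using that by (simp add: lie_automorphisms_def)
    show ?thesis
      by (metis inv matrix_inv_left matrix_inv_right matrix_mul_assoc matrix_mul_lid)
  qed
  then show ?thesis by (auto simp: aut_orbit_def)
qed

lemma aut_orbit_refl: "J \<in> aut_orbit br J"
proof -
  have "mat 1 \<in> lie_automorphisms br"
    by (auto simp: lie_automorphisms_def invertible_def intro: exI[of _ "mat 1"])
  then show ?thesis unfolding in_aut_orbit_iff
    by (intro bexI[of _ "mat 1"]) simp_all
qed

lemma aut_orbit_sym:
  assumes "J \<in> aut_orbit br K"
  shows "K \<in> aut_orbit br J"
proof -
  obtain \<Phi> where \<Phi>: "\<Phi> \<in> lie_automorphisms br" "\<Phi> ** J = K ** \<Phi>"
    using assms in_aut_orbit_iff by blast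
  then have inv: "invertible \<Phi>" by (simp add: lie_automorphisms_def)
  have "matrix_inv \<Phi> ** K = J ** matrix_inv \<Phi>"
    by (metis \<Phi>(2) inv matrix_inv_left matrix_inv_right matrix_mul_assoc matrix_mul_lid matrix_mul_rid)
  then show ?thesis
    using lie_automorphism_inverse[OF \<Phi>(1)] in_aut_orbit_iff by blast
qed

lemma aut_orbit_trans:
  assumes "J \<in> aut_orbit br K" "K \<in> aut_orbit br M"
  shows "J \<in> aut_orbit br M"
proof -
  obtain \<Phi> where \<Phi>: "\<Phi> \<in> lie_automorphisms br" "\<Phi> ** J = K ** \<Phi>"
    using assms(1) in_aut_orbit_iff by blast
  obtain \<Psi> where \<Psi>: "\<Psi> \<in> lie_automorphisms br" "\<Psi> ** K = M ** \<Psi>"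
    using assms(2) in_aut_orbit_iff by blast
  have "(\<Psi> ** \<Phi>) ** J = M ** (\<Psi> ** \<Phi>)"
    by (metis \<Phi>(2) \<Psi>(2) matrix_mul_assoc)
  then show ?thesis
    using lie_automorphism_mult[OF \<Psi>(1) \<Phi>(1)] in_aut_orbit_iff by blast
qed

text \<open>Since \<open>\<Phi>\<close> preserves brackets and intertwines \<open>J\<close> with
  \<open>K\<close>, it carries each defining equation of \<open>J\<close> to that of
  \<open>K\<close> at the image vectors. Injectivity of \<open>\<Phi>\<close> brings the equation
  back.\<close>

lemma aut_orbit_complex_structures:
  assumes K: "K \<in> complex_structures br" and "J \<in> aut_orbit br K"
  shows "J \<in> complex_structures br"
proof -
  obtain \<Phi> where \<Phi>: "\<Phi> \<in> lie_automorphisms br" "\<Phi> ** J = K ** \<Phi>"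
    using assms(2) in_aut_orbit_iff by blast
  then have inv: "invertible \<Phi>" and hom: "\<Phi> *v br X Y = br (\<Phi> *v X) (\<Phi> *v Y)" for X Y
    by (auto simp: lie_automorphisms_def)
  have swap: "\<Phi> *v (J *v X) = K *v (\<Phi> *v X)" for X
    by (simp add: matrix_vector_mul_assoc \<Phi>(2))
  have cancel: "X = Y" if "\<Phi> *v X = \<Phi> *v Y" for X Y
    using that by (metis inv matrix_inv_left matrix_vector_mul_assoc matrix_vector_mul_lid)
  have "\<Phi> *v (J *v (J *v X)) = \<Phi> *v (- X)" for X
    using K by (simp add: swap complex_structures_def square_minus_one_iff
        vec.neg)
  moreover have "\<Phi> *v (br (J *v X) (J *v Y) - br X Y - J *v br (J *v X) Y - J *v br X (J *v Y)) = \<Phi> *v 0"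
    for X Y
    using K by (simp add: swap hom complex_structures_def vec.diff)
  ultimately show ?thesis
    using cancel unfolding complex_structures_def square_minus_one_iff by blast
qed

section \<open>Inequivalence of the model structures\<close>

lemma J67_entries:
  "J67 \<alpha> *v X = vector [X$2, - (X$1), \<alpha> * X$4, - (X$3 / \<alpha>), - (\<alpha> / (\<alpha> - 1)) * X$6, (\<alpha> - 1) / \<alpha> * X$5]"
  by (simp add: J67_def matrix_vector_mult_def sum_6 vec_eq_iff forall_6)

lemma J67_complex_structure:
  assumes "\<alpha> \<noteq> 0" "\<alpha> \<noteq> 1"
  shows "J67 \<alpha> \<in> complex_structures bracket67"
proof -
  have "J67 \<alpha> *v (J67 \<alpha> *v X) = - X" for X
    using assms by (simp add: J67_entries vec_eq_iff forall_6)
  moreover have "bracket67 (J67 \<alpha> *v X) (J67 \<alpha> *v Y) - bracket67 X Y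
      - J67 \<alpha> *v bracket67 (J67 \<alpha> *v X) Y - J67 \<alpha> *v bracket67 X (J67 \<alpha> *v Y) = 0" for X Y
    using assms
    by (simp add: J67_entries vec_eq_iff forall_6 bracket67_components divide_simps) (simp add: algebra_simps)
  ultimately show ?thesis
    by (simp add: complex_structures_def square_minus_one_iff)
qed

text \<open>The bracket relations together with the intertwining relation force the entries
  \<open>F$3$3\<close> and \<open>F$4$4\<close> of the intertwiner \<open>F\<close> to be equal and
  nonzero, while \<open>J67\<close> at \<open>x4\<close> gives
  \<open>\<alpha> * F$3$3 = \<beta> * F$4$4\<close>.\<close>

lemma J67_equivalent_imp_eq:
  assumes "\<alpha> \<noteq> 0" "\<beta> \<noteq> 0"
    and "J67 \<alpha> \<in> aut_orbit bracket67 (J67 \<beta>)"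
  shows "\<alpha> = \<beta>"
proof -
  obtain F where F: "F \<in> lie_automorphisms bracket67" and FJ: "F ** J67 \<alpha> = J67 \<beta> ** F"
    using assms(3) in_aut_orbit_iff by blast
  have inv: "invertible F" and hom: "F *v bracket67 X Y = bracket67 (F *v X) (F *v Y)" for X Y
    using F by (auto simp: lie_automorphisms_def)
  have entry: "(F *v x67 j) $ i = F $ i $ j" for i j
    by (simp add: matrix_vector_mult_basis column_def)
  have F4: "F *v x67 4 = bracket67 (F *v x67 1) (F *v x67 2)"
    and F5: "F *v x67 5 = bracket67 (F *v x67 1) (F *v x67 3)"
    and F6: "F *v x67 6 = bracket67 (F *v x67 1) (F *v x67 4)"
    and F23: "- (F *v x67 6) = bracket67 (F *v x67 2) (F *v x67 3)"
    and F24: "0 = bracket67 (F *v x67 2) (F *v x67 4)"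
    and F34: "0 = bracket67 (F *v x67 3) (F *v x67 4)"
    using hom[of "x67 1" "x67 2"] hom[of "x67 1" "x67 3"] hom[of "x67 1" "x67 4"]
      hom[of "x67 2" "x67 3"] hom[of "x67 2" "x67 4"] hom[of "x67 3" "x67 4"]
    by (simp_all add: bracket67_basis bracket67_basis_zero vec.neg)
  have J: "F *v (J67 \<alpha> *v X) = J67 \<beta> *v (F *v X)" for X
    by (simp add: matrix_vector_mul_assoc FJ)
  have c4: "F$1$4 = 0" "F$2$4 = 0" "F$3$4 = 0" "F$4$4 = F$1$1 * F$2$2 - F$2$1 * F$1$2"
    using F4 by (simp_all add: vec_eq_iff forall_6 bracket67_components entry)
  have c6: "F$1$6 = 0" "F$2$6 = 0" "F$3$6 = 0" "F$4$6 = 0" "F$5$6 = 0" "F$6$6 = F$1$1 * F$4$4"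
    using F6 c4 by (simp_all add: vec_eq_iff forall_6 bracket67_components entry)
  have "F *v x67 6 \<noteq> 0"
  proof
    assume "F *v x67 6 = 0"
    then have "x67 6 = 0"
      using inv by (metis invertible_left_inverse matrix_left_invertible_ker)
    then show False by (simp add: axis_eq_0_iff)
  qed
  then have "F$6$6 \<noteq> 0"
    using c6 by (auto simp: vec_eq_iff forall_6 entry)
  then have nz: "F$1$1 \<noteq> 0" "F$4$4 \<noteq> 0" using c6 by auto
  \<comment> \<open>Modulo \<open>x4\<close> and \<open>x5\<close>, the brackets of
    \<open>F x2\<close> and \<open>F x3\<close> with \<open>F x4\<close> are
    \<open>F$1$2 * F$4$4\<close> and \<open>F$1$3 * F$4$4\<close> times \<open>x6\<close>, and both
    must vanish.\<close>
  have F12: "F$1$2 = 0" "F$1$3 = 0"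
    using F24 F34 c4 nz by (simp_all add: vec_eq_iff forall_6 bracket67_components entry)
  have "F$2$1 = 0" "F$2$2 = F$1$1"
    using J[of "x67 1"] F12
    by (simp_all add: J67_basis vec.neg) (simp_all add: J67_entries vec_eq_iff forall_6 entry)
  moreover have "F$2$3 = 0" "\<alpha> * F$3$3 = \<beta> * F$4$4"
    using J[of "x67 4"] c4 assms(1)
    by (simp_all add: J67_basis matrix_vector_mult_scaleR) (simp_all add: J67_entries vec_eq_iff forall_6 entry)
  \<comment> \<open>A second expression for \<open>F$6$6\<close>, from
    \<open>[x2, x3] = - x6\<close>; the first came from \<open>[x1, x4] = x6\<close>. With
    \<open>F$2$2 = F$1$1\<close> and \<open>F$2$3 = 0\<close> the two give
    \<open>F$3$3 = F$4$4\<close>.\<close>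
  moreover have "F$6$6 = F$2$2 * F$3$3 - F$3$2 * F$2$3"
    using F23 F12 by (simp add: vec_eq_iff forall_6 bracket67_components entry)
  ultimately show ?thesis
    using c4 c6 F12 nz by auto
qed

lemma equivalent_J67_imp_eq:
  assumes "\<alpha> \<noteq> 0" "\<beta> \<noteq> 0" "equivalent_structures bracket67 (J67 \<alpha>) (J67 \<beta>)"
  shows "\<alpha> = \<beta>"
  using assms J67_equivalent_imp_eq aut_orbit_sym aut_orbit_trans
  unfolding equivalent_structures_def by metis

section \<open>Normal form\<close>

text \<open>The last condition is the vanishing of the Nijenhuis tensor at \<open>(x2, x4)\<close>.\<close>

definition adapted67 :: "real^6^6 \<Rightarrow> bool"
  where "adapted67 J \<longleftrightarrow>
    J ** J = - mat 1 \<and> J$1$4 = 0 \<and> J$2$4 = 0 \<and>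
    J$1$2 \<noteq> 0 \<and> J$3$4 \<noteq> 0 \<and> J$1$2 \<noteq> J$3$4 \<and>
    J *v x67 6 = (J$1$2 * J$3$4 / (J$1$2 - J$3$4)) *\<^sub>R x67 5
      + ((J$1$2 * J$4$4 - J$2$2 * J$3$4) / (J$1$2 - J$3$4)) *\<^sub>R x67 6"

lemma matrix_vector_mult_axis_nth [simp]:
  fixes A :: "real^'n^'m"
  shows "(A *v axis j 1) $ i = A $ i $ j"
  by (simp add: matrix_vector_mult_basis column_def)

lemma axis_component: "axis j c $ i = (if i = j then c else 0)"
  by (simp add: axis_def)

text \<open>The flag is obtained from the bottom: first \<open>J x6\<close>, then
  \<open>J x5\<close>, lie in the span of \<open>x5, x6\<close>; then \<open>J x4\<close> and
  \<open>J x3\<close> lie in the span of \<open>x3, ..., x6\<close>. Only then is the Nijenhuis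
  tensor at \<open>(x2, x4)\<close> evaluated.\<close>

lemma complex_structure_imp_adapted67:
  assumes "J \<in> complex_structures bracket67"
  shows "adapted67 J"
proof -
  have sq: "J *v (J *v X) = - X" for X
    using assms square_minus_one_iff[of J] by (simp add: complex_structures_def)
  have N: "bracket67 (J *v X) (J *v Y) - bracket67 X Y = J *v bracket67 (J *v X) Y + J *v bracket67 X (J *v Y)"
    for X Y
    using assms by (simp add: complex_structures_def algebra_simps)
  have sq_entry: "J$i$1 * J$1$j + J$i$2 * J$2$j + J$i$3 * J$3$j + J$i$4 * J$4$j + J$i$5 * J$5$j + J$i$6 * J$6$j
      = - (x67 j $ i)" for i j
    using arg_cong[OF sq[of "x67 j"], of "\<lambda>v. v $ i"]
    by (simp add: matrix_vector_mult_def[of J "J *v x67 j"] sum_6)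
  define W where "W = J *v x67 6"
  have W: "W$i = J$i$6" for i by (simp add: W_def)
  have comm: "bracket67 W (J *v Y) = J *v bracket67 W Y" for Y
  proof -
    have "bracket67 (x67 6) Z = 0" for Z
      by (simp add: vec_eq_iff forall_6 bracket67_components axis_component)
    then show ?thesis using N[of "x67 6" Y] by (simp add: W_def)
  qed
  \<comment> \<open>\<open>ad W\<close> commutes with \<open>J\<close>, hence so does its square, which has rank at most one.\<close>
  have "bracket67 W (bracket67 W (J *v x67 2)) = J *v bracket67 W (bracket67 W (x67 2))"
    by (simp add: comm)
  moreover have "bracket67 W (bracket67 W (x67 2)) = (W$1 * W$1) *\<^sub>R x67 6"
    by (simp add: vec_eq_iff forall_6 bracket67_components axis_component)
  ultimately have "bracket67 W (bracket67 W (J *v x67 2)) $ 1 = W$1 * W$1 * W$1"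
    by (simp add: matrix_vector_mult_scaleR W)
  then have W1: "W$1 = 0" by (simp add: bracket67_components)
  \<comment> \<open>The vectors \<open>x3\<close>, \<open>x2\<close>, \<open>x1\<close> are taken in
    this order because, once the earlier coordinates of \<open>W\<close> vanish, \<open>ad W\<close>
    sends each to plus or minus the next coordinate times \<open>x6\<close>. Applying
    \<open>J\<close> turns \<open>x6\<close> into \<open>W\<close>, so the square of that coordinate
    is, up to sign, a component of a bracket that is zero.\<close>
  have "bracket67 W (x67 3) = (- (W$2)) *\<^sub>R x67 6"
    using W1 by (simp add: vec_eq_iff forall_6 bracket67_components axis_component)
  then have "bracket67 W (J *v x67 3) $ 2 = - (W$2 * W$2)"
    using comm[of "x67 3"] by (simp only: matrix_vector_mult_scaleR) (simp add: W)
  then have W2: "W$2 = 0" by (simp add: bracket67_components)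
  have "bracket67 W (x67 2) = (W$3) *\<^sub>R x67 6"
    using W1 W2 by (simp add: vec_eq_iff forall_6 bracket67_components axis_component)
  then have "bracket67 W (J *v x67 2) $ 3 = W$3 * W$3"
    using comm[of "x67 2"] by (simp only: matrix_vector_mult_scaleR) (simp add: W)
  then have W3: "W$3 = 0" by (simp add: bracket67_components)
  have "bracket67 W (x67 1) = (- (W$4)) *\<^sub>R x67 6"
    using W1 W2 W3 by (simp add: vec_eq_iff forall_6 bracket67_components axis_component)
  then have "bracket67 W (J *v x67 1) $ 4 = - (W$4 * W$4)"
    using comm[of "x67 1"] by (simp only: matrix_vector_mult_scaleR) (simp add: W)
  then have W4: "W$4 = 0" using W1 W2 W3 by (simp add: bracket67_components)
  have J6: "J$1$6 = 0" "J$2$6 = 0" "J$3$6 = 0" "J$4$6 = 0"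
    using W1 W2 W3 W4 by (simp_all add: W)
  have sq_pos: "a * a \<noteq> - 1" for a :: real
    by (metis neg_0_le_iff_le not_one_le_zero zero_le_square)
  \<comment> \<open>Otherwise \<open>J\<close> would preserve the real line of \<open>x6\<close>,
    and \<open>J$6$6\<close> would square to -1. The entries \<open>J$3$4\<close> and
    \<open>J$1$2\<close> are nonzero for the same reason in the higher layers of the flag.\<close>
  have "J$5$6 \<noteq> 0"
    using sq_entry[of 6 6] sq_pos J6 by (auto simp: axis_component)
  then have J5: "J$1$5 = 0" "J$2$5 = 0" "J$3$5 = 0" "J$4$5 = 0"
    using sq_entry[of 1 6] sq_entry[of 2 6] sq_entry[of 3 6] sq_entry[of 4 6] J6
    by (simp_all add: axis_component)
  have N4: "bracket67 (J *v x67 4) (J *v Y) - bracket67 (x67 4) Y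
      = J *v bracket67 (J *v x67 4) Y + J *v bracket67 (x67 4) (J *v Y)" for Y
    by (rule N)
  \<comment> \<open>Modulo the span of \<open>x5, x6\<close>, which \<open>J\<close> preserves,
    \<open>[J x4, x2]\<close> is \<open>J$1$4\<close> times \<open>x4\<close>. Component 1 of
    integrability thus reads \<open>J$1$4\<close> squared equals 0; with \<open>x1\<close> for
    \<open>x2\<close>, component 2 does the same for \<open>J$2$4\<close>.\<close>
  have J14: "J$1$4 = 0"
    using arg_cong[OF N4[of "x67 2"], of "\<lambda>v. v $ 1"] J5 J6
    by (simp add: matrix_vector_mult_def[of J "bracket67 _ _"] sum_6 bracket67_components)
      (simp add: axis_component)
  have J24: "J$2$4 = 0"
    using arg_cong[OF N4[of "x67 1"], of "\<lambda>v. v $ 2"] J5 J6 J14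
    by (simp add: matrix_vector_mult_def[of J "bracket67 _ _"] sum_6 bracket67_components)
      (simp add: axis_component)
  have J34: "J$3$4 \<noteq> 0"
    using sq_entry[of 4 4] sq_pos J14 J24 J5 J6 by (auto simp: axis_component)
  have J3: "J$1$3 = 0" "J$2$3 = 0"
    using sq_entry[of 1 4] sq_entry[of 2 4] J14 J24 J34 J5 J6 by (simp_all add: axis_component)
  have J12: "J$1$2 \<noteq> 0"
    using sq_entry[of 1 1] sq_pos J14 J24 J5 J6 J3 by (auto simp: axis_component)
  have "bracket67 (J *v x67 2) (J *v x67 4) =
      (J$1$2 * J$3$4) *\<^sub>R x67 5 + (J$1$2 * J$4$4 - J$2$2 * J$3$4) *\<^sub>R x67 6"
    using J14 J24 by (simp add: vec_eq_iff forall_6 bracket67_components) (simp add: axis_component)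
  moreover have "bracket67 (J *v x67 2) (x67 4) = (J$1$2) *\<^sub>R x67 6"
    by (simp add: vec_eq_iff forall_6 bracket67_components) (simp add: axis_component)
  moreover have "bracket67 (x67 2) (J *v x67 4) = (- (J$3$4)) *\<^sub>R x67 6"
    using J14 J24 by (simp add: vec_eq_iff forall_6 bracket67_components) (simp add: axis_component)
  ultimately have key: "(J$1$2 * J$3$4) *\<^sub>R x67 5 + (J$1$2 * J$4$4 - J$2$2 * J$3$4) *\<^sub>R x67 6
      = (J$1$2 - J$3$4) *\<^sub>R (J *v x67 6)"
    using N[of "x67 2" "x67 4"]
    by (simp only: matrix_vector_mult_scaleR bracket67_basis_zero) (simp add: algebra_simps)
  \<comment> \<open>Component 5 of the left side of \<open>key\<close> is
    \<open>J$1$2 * J$3$4\<close>, which is nonzero, so the scalar factor on the right cannot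
    vanish.\<close>
  have "J$1$2 \<noteq> J$3$4"
    using arg_cong[OF key, of "\<lambda>v. v $ 5"] J12 J34 by (auto simp: axis_component)
  moreover from this have "J *v x67 6 = (1 / (J$1$2 - J$3$4)) *\<^sub>R
      ((J$1$2 * J$3$4) *\<^sub>R x67 5 + (J$1$2 * J$4$4 - J$2$2 * J$3$4) *\<^sub>R x67 6)"
    unfolding key by simp
  then have "J *v x67 6 = (J$1$2 * J$3$4 / (J$1$2 - J$3$4)) *\<^sub>R x67 5
      + ((J$1$2 * J$4$4 - J$2$2 * J$3$4) / (J$1$2 - J$3$4)) *\<^sub>R x67 6"
    by (simp add: scaleR_add_right)
  ultimately show ?thesis
    using assms J14 J24 J34 J12 by (simp add: adapted67_def complex_structures_def)
qed

section \<open>Automorphisms with prescribed columns\<close>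

definition cols67 :: "real^6 \<Rightarrow> real^6 \<Rightarrow> real^6 \<Rightarrow> real^6 \<Rightarrow> real^6 \<Rightarrow> real^6 \<Rightarrow> real^6^6"
  where "cols67 c1 c2 c3 c4 c5 c6 = transpose (vector [c1, c2, c3, c4, c5, c6])"

lemma cols67_entries [simp]:
  "cols67 c1 c2 c3 c4 c5 c6 $ i $ 1 = c1 $ i"
  "cols67 c1 c2 c3 c4 c5 c6 $ i $ 2 = c2 $ i"
  "cols67 c1 c2 c3 c4 c5 c6 $ i $ 3 = c3 $ i"
  "cols67 c1 c2 c3 c4 c5 c6 $ i $ 4 = c4 $ i"
  "cols67 c1 c2 c3 c4 c5 c6 $ i $ 5 = c5 $ i"
  "cols67 c1 c2 c3 c4 c5 c6 $ i $ 6 = c6 $ i"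
  by (simp_all add: cols67_def transpose_def)

lemma cols67_axis [simp]:
  "cols67 c1 c2 c3 c4 c5 c6 *v x67 1 = c1"
  "cols67 c1 c2 c3 c4 c5 c6 *v x67 2 = c2"
  "cols67 c1 c2 c3 c4 c5 c6 *v x67 3 = c3"
  "cols67 c1 c2 c3 c4 c5 c6 *v x67 4 = c4"
  "cols67 c1 c2 c3 c4 c5 c6 *v x67 5 = c5"
  "cols67 c1 c2 c3 c4 c5 c6 *v x67 6 = c6"
  by (simp_all add: vec_eq_iff)

text \<open>With \<open>x1\<close> sent to \<open>y\<close>, \<open>x2\<close> fixed and
  \<open>x3\<close> sent to \<open>h\<close>, the remaining columns are the brackets
  \<open>[y, x2]\<close>, \<open>[y, h]\<close> and \<open>[y, [y, x2]]\<close>. The condition on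
  \<open>h$3\<close> makes \<open>[x2, x3] = - x6\<close> compatible with them. The matrix is lower
  triangular with powers of \<open>y$1\<close> on the diagonal, hence invertible.\<close>

lemma cols67_automorphism:
  assumes "P = cols67 y (x67 2) h (y$1 *\<^sub>R x67 4 + y$3 *\<^sub>R x67 6) g ((y$1 * y$1) *\<^sub>R x67 6)"
    and y1: "y$1 \<noteq> 0"
    and h: "h$1 = 0" "h$2 = 0" "h$3 = y$1 * y$1"
    and g: "g = (y$1 * h$3) *\<^sub>R x67 5 + (y$1 * h$4 - y$2 * h$3) *\<^sub>R x67 6"
  shows "P \<in> lie_automorphisms bracket67"
proof -
  have P: "P *v X = vector [X$1 * y$1, X$1 * y$2 + X$2, X$1 * y$3 + X$3 * h$3,
      X$1 * y$4 + X$3 * h$4 + X$4 * y$1, X$1 * y$5 + X$3 * h$5 + X$5 * g$5,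
      X$1 * y$6 + X$3 * h$6 + X$4 * y$3 + X$5 * g$6 + X$6 * (y$1 * y$1)]" for X
    unfolding assms(1)
    by (simp add: matrix_vector_mult_def sum_6 vec_eq_iff forall_6 g h axis_component algebra_simps)
  have "P *v bracket67 X Y = bracket67 (P *v X) (P *v Y)" for X Y
    unfolding P
    by (simp add: vec_eq_iff forall_6 bracket67_components g h axis_component algebra_simps)
  moreover have "X = 0" if "P *v X = 0" for X
  proof -
    have "X$1 = 0" using that y1 unfolding P by (simp add: vec_eq_iff forall_6)
    moreover from this have "X$2 = 0" "X$3 = 0" using that y1 unfolding P by (simp_all add: vec_eq_iff forall_6 h)
    moreover from calculation have "X$4 = 0" "X$5 = 0" using that y1 unfolding P
      by (simp_all add: vec_eq_iff forall_6 g h axis_component)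
    moreover from calculation have "X$6 = 0" using that y1 unfolding P
      by (simp add: vec_eq_iff forall_6)
    ultimately show ?thesis by (simp add: vec_eq_iff forall_6)
  qed
  then have "invertible P"
    by (simp add: invertible_left_inverse matrix_left_invertible_ker)
  ultimately show ?thesis by (simp add: lie_automorphisms_def)
qed

text \<open>With \<open>x1, x2\<close> sent to \<open>J x2, x2\<close>, the other columns of the automorphism are forced: \<open>x4\<close> goes to
  \<open>[J x2, x2]\<close>, \<open>J67\<close> then gives the image of \<open>x3\<close>, and brackets give those of \<open>x5\<close> and \<open>x6\<close>.\<close>

lemma adapted67_imp_orbit:
  assumes "adapted67 J"
  shows "J \<in> aut_orbit bracket67 (J67 (J$3$4 / J$1$2))"
proof -
  define p q m w where "p = J$1$2" and "q = J$3$4" and "m = J$3$2" and "w = J *v x67 6"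
  have sq: "J *v (J *v X) = - X" for X
    using assms square_minus_one_iff[of J] by (simp add: adapted67_def)
  have nz: "p \<noteq> 0" "q \<noteq> 0" "p \<noteq> q" and J4: "J$1$4 = 0" "J$2$4 = 0"
    and w: "w = (p * q / (p - q)) *\<^sub>R x67 5 + ((p * J$4$4 - J$2$2 * q) / (p - q)) *\<^sub>R x67 6"
    using assms by (auto simp: adapted67_def p_def q_def w_def)
  \<comment> \<open>Put \<open>\<alpha> = q / p\<close>. \<open>h\<close> and \<open>g\<close> are
    solved from \<open>J ** P = P ** J67 \<alpha>\<close> at \<open>x4\<close> and at
    \<open>x6\<close>, where \<open>J67 \<alpha>\<close> produces multiples of \<open>x3\<close> and
    \<open>x5\<close>.\<close>
  define h where "h = (p / q) *\<^sub>R (p *\<^sub>R (J *v x67 4) + m *\<^sub>R w)"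
  define g where "g = (((p - q) / q) * (p * p)) *\<^sub>R w"
  have h: "h$1 = 0" "h$2 = 0" "h$3 = p * p" "h$4 = p / q * (p * J$4$4)"
    using nz J4 by (simp_all add: h_def w axis_component q_def[symmetric])
  \<comment> \<open>The right side is \<open>[J x2, h]\<close>: the formula for \<open>J x6\<close>
    in \<open>adapted67\<close> is what makes the column dictated by \<open>J67\<close> agree with
    the one dictated by the bracket.\<close>
  have g: "g = (p * h$3) *\<^sub>R x67 5 + (p * h$4 - J$2$2 * h$3) *\<^sub>R x67 6"
    using nz by (simp add: vec_eq_iff forall_6 g_def w h axis_component divide_simps) (simp add: algebra_simps)
  define P where "P = cols67 (J *v x67 2) (x67 2) h (p *\<^sub>R x67 4 + m *\<^sub>R x67 6) g ((p * p) *\<^sub>R x67 6)"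
  have "P \<in> lie_automorphisms bracket67"
    using nz h g by (intro cols67_automorphism[of P "J *v x67 2" h g]) (simp_all add: P_def p_def m_def)
  moreover have "J ** P = P ** J67 (q / p)"
  proof (rule matrix_eq_axisI)
    have "(J ** P) *v x67 j = (P ** J67 (q / p)) *v x67 j" if "j \<in> {1, 2, 3, 4, 5, 6}" for j
      using that nz
      by (elim insertE emptyE)
        (simp_all add: matrix_vector_mul_assoc[symmetric] J67_basis P_def vec.neg sq
          matrix_vector_mult_scaleR vec.add h_def g_def w_def divide_simps,
        simp_all add: vec_eq_iff divide_simps, simp_all add: algebra_simps)
    then show "(J ** P) *v x67 j = (P ** J67 (q / p)) *v x67 j" for j
      using UNIV_6 by auto
  qed
  ultimately have "J67 (q / p) \<in> aut_orbit bracket67 J"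
    using in_aut_orbit_iff by metis
  then show ?thesis using aut_orbit_sym p_def q_def by blast
qed

text \<open>For the converse, integrability is transported from the model \<open>J67\<close> along
  the orbit; the parameter \<open>J$3$4 / J$1$2\<close> avoids 0 and 1 by the inequalities in
  \<open>adapted67\<close>.\<close>

lemma complex_structures_iff_adapted67: "J \<in> complex_structures bracket67 \<longleftrightarrow> adapted67 J"
proof
  assume "adapted67 J"
  moreover from this have "J67 (J$3$4 / J$1$2) \<in> complex_structures bracket67"
    by (intro J67_complex_structure) (auto simp: adapted67_def)
  ultimately show "J \<in> complex_structures bracket67"
    using adapted67_imp_orbit aut_orbit_complex_structures by blast
qed (rule complex_structure_imp_adapted67)

lemma complex_structures_67_eq:
  "complex_structures bracket67 = (\<Union>\<alpha>\<in>UNIV - {0, 1}. aut_orbit bracket67 (J67 \<alpha>))"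
proof -
  have "J$3$4 / J$1$2 \<in> UNIV - {0, 1}" if "adapted67 J" for J
    using that by (auto simp: adapted67_def)
  then show ?thesis
    using adapted67_imp_orbit complex_structures_iff_adapted67
      aut_orbit_complex_structures[OF J67_complex_structure]
    by fast
qed

section \<open>The complex structures as a graph\<close>

text \<open>Column \<open>j\<close> of a complex structure as a function of the ten free entries: \<open>rec2\<close> and \<open>rec4\<close> are
  the free columns, \<open>rec6\<close> comes from integrability, and \<open>rec5\<close>, \<open>rec3\<close>, \<open>rec1\<close> solve
  \<open>J (J x6) = - x6\<close>, \<open>J (J x4) = - x4\<close>, \<open>J (J x2) = - x2\<close>.\<close>

definition rec6 :: "real^6^6 \<Rightarrow> real^6"
  where "rec6 M = (M$1$2 * M$3$4 / (M$1$2 - M$3$4)) *\<^sub>R x67 5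
    + ((M$1$2 * M$4$4 - M$2$2 * M$3$4) / (M$1$2 - M$3$4)) *\<^sub>R x67 6"

definition rec5 :: "real^6^6 \<Rightarrow> real^6"
  where "rec5 M = (- (M$1$2 - M$3$4) / (M$1$2 * M$3$4)) *\<^sub>R
    (x67 6 + ((M$1$2 * M$4$4 - M$2$2 * M$3$4) / (M$1$2 - M$3$4)) *\<^sub>R rec6 M)"

definition rec4 :: "real^6^6 \<Rightarrow> real^6"
  where "rec4 M = M$3$4 *\<^sub>R x67 3 + M$4$4 *\<^sub>R x67 4 + M$5$4 *\<^sub>R x67 5 + M$6$4 *\<^sub>R x67 6"

definition rec3 :: "real^6^6 \<Rightarrow> real^6"
  where "rec3 M = (- 1 / M$3$4) *\<^sub>R
    (x67 4 + M$4$4 *\<^sub>R rec4 M + M$5$4 *\<^sub>R rec5 M + M$6$4 *\<^sub>R rec6 M)"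

definition rec2 :: "real^6^6 \<Rightarrow> real^6"
  where "rec2 M = M$1$2 *\<^sub>R x67 1 + M$2$2 *\<^sub>R x67 2 + M$3$2 *\<^sub>R x67 3
    + M$4$2 *\<^sub>R x67 4 + M$5$2 *\<^sub>R x67 5 + M$6$2 *\<^sub>R x67 6"

definition rec1 :: "real^6^6 \<Rightarrow> real^6"
  where "rec1 M = (- 1 / M$1$2) *\<^sub>R
    (x67 2 + M$2$2 *\<^sub>R rec2 M + M$3$2 *\<^sub>R rec3 M + M$4$2 *\<^sub>R rec4 M + M$5$2 *\<^sub>R rec5 M + M$6$2 *\<^sub>R rec6 M)"

definition recon67 :: "real^6^6 \<Rightarrow> real^6^6"
  where "recon67 M = cols67 (rec1 M) (rec2 M) (rec3 M) (rec4 M) (rec5 M) (rec6 M)"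

text \<open>The linear projection that keeps the ten free entries and sets all others to
  zero.\<close>

definition param67 :: "real^6^6 \<Rightarrow> real^6^6"
  where "param67 M = cols67 0 (rec2 M) 0 (rec4 M) 0 0"

text \<open>The open set on which all denominators in the reconstruction are nonzero.\<close>

definition U67 :: "(real^6^6) set"
  where "U67 = {M. M$1$2 \<noteq> 0 \<and> M$3$4 \<noteq> 0 \<and> M$1$2 \<noteq> M$3$4}"

section \<open>Reconstruction yields exactly the adapted matrices\<close>

lemma rec2_components: "rec2 M $ i = M $ i $ 2"
  using forall_6[of "\<lambda>i. rec2 M $ i = M $ i $ 2"] by (simp add: rec2_def axis_component)

lemma rec4_components:
  "rec4 M $ 1 = 0" "rec4 M $ 2 = 0" "rec4 M $ 3 = M$3$4" "rec4 M $ 4 = M$4$4"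
  "rec4 M $ 5 = M$5$4" "rec4 M $ 6 = M$6$4"
  by (simp_all add: rec4_def axis_component)

text \<open>Columns 5, 3 and 1 were chosen so that \<open>J (J x) = - x\<close> holds at
  \<open>x6\<close>, \<open>x4\<close> and \<open>x2\<close>. Going down from \<open>x6\<close>, the
  equation at each odd index then follows by applying \<open>J\<close> to the formula for that
  column.\<close>

lemma adapted67_recon67:
  assumes "M \<in> U67"
  shows "adapted67 (recon67 M)"
proof -
  define J where "J = recon67 M"
  have nz: "M$1$2 \<noteq> 0" "M$3$4 \<noteq> 0" "M$1$2 - M$3$4 \<noteq> 0" using assms by (auto simp: U67_def)
  define a b where "a = M$1$2 * M$3$4 / (M$1$2 - M$3$4)"
    and "b = (M$1$2 * M$4$4 - M$2$2 * M$3$4) / (M$1$2 - M$3$4)"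
  have a: "a \<noteq> 0" using nz by (simp add: a_def)
  have cols: "J *v x67 1 = rec1 M" "J *v x67 2 = rec2 M" "J *v x67 3 = rec3 M"
    "J *v x67 4 = rec4 M" "J *v x67 5 = rec5 M" "J *v x67 6 = rec6 M"
    by (simp_all add: J_def recon67_def)
  note lin = vec.add vec.neg matrix_vector_mult_scaleR
  have rec6: "rec6 M = a *\<^sub>R x67 5 + b *\<^sub>R x67 6"
    by (simp add: rec6_def a_def b_def)
  have rec5: "rec5 M = (- 1 / a) *\<^sub>R (x67 6 + b *\<^sub>R rec6 M)"
    using nz by (simp add: rec5_def a_def b_def minus_divide_left)
  have s6: "J *v rec6 M = - x67 6"
    using a unfolding rec6 by (simp add: lin cols rec5)
  have s5: "J *v rec5 M = - x67 5"
    using a by (simp add: rec5 lin cols s6) (simp add: rec6 scaleR_add_right)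
  have s4: "J *v rec4 M = - x67 4"
    unfolding rec4_def[of M] using nz by (simp add: lin cols rec3_def)
  have s3: "J *v rec3 M = - x67 3"
    using nz by (simp add: rec3_def lin cols s4 s5 s6)
      (simp add: rec4_def vec_eq_iff divide_simps)
  have s2: "J *v rec2 M = - x67 2"
    unfolding rec2_def[of M] using nz by (simp add: lin cols rec1_def)
  have s1: "J *v rec1 M = - x67 1"
    using nz by (simp add: rec1_def lin cols s2 s3 s4 s5 s6)
      (simp add: rec2_def vec_eq_iff divide_simps)
  have "J ** J = - mat 1"
  proof (rule matrix_eq_axisI)
    have "(J ** J) *v x67 j = (- mat 1) *v x67 j" if "j \<in> {1, 2, 3, 4, 5, 6}" for j
      using that unfolding minus_mat_1_mult_vec
      by (elim insertE emptyE)
        (simp_all only: matrix_vector_mul_assoc[symmetric] cols s1 s2 s3 s4 s5 s6)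
    then show "(J ** J) *v x67 j = (- mat 1) *v x67 j" for j
      using UNIV_6 by auto
  qed
  moreover have "J$1$2 = M$1$2" "J$2$2 = M$2$2" "J$3$4 = M$3$4" "J$4$4 = M$4$4" "J$1$4 = 0" "J$2$4 = 0"
    by (simp_all add: J_def recon67_def rec2_components rec4_components)
  ultimately have "adapted67 J"
    using nz by (simp add: adapted67_def cols rec6_def)
  then show ?thesis by (simp add: J_def)
qed

text \<open>The square condition at \<open>x6\<close>, \<open>x4\<close>, \<open>x2\<close> is a
  linear equation for columns 5, 3, 1 in turn; the coefficients \<open>a\<close>,
  \<open>J$3$4\<close>, \<open>J$1$2\<close> are nonzero, so the solution is unique and is the
  reconstructed column.\<close>

lemma recon67_adapted67:
  assumes "adapted67 J"
  shows "recon67 J = J" and "J \<in> U67"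
proof -
  show "J \<in> U67" using assms by (auto simp: adapted67_def U67_def)
  have nz: "J$1$2 \<noteq> 0" "J$3$4 \<noteq> 0" "J$1$2 - J$3$4 \<noteq> 0" and J4: "J$1$4 = 0" "J$2$4 = 0"
    using assms by (auto simp: adapted67_def)
  have sq: "J *v (J *v X) = - X" for X
    using assms square_minus_one_iff[of J] by (simp add: adapted67_def)
  define a b where "a = J$1$2 * J$3$4 / (J$1$2 - J$3$4)"
    and "b = (J$1$2 * J$4$4 - J$2$2 * J$3$4) / (J$1$2 - J$3$4)"
  have a: "a \<noteq> 0" using nz by (simp add: a_def)
  note lin = vec.add vec.neg matrix_vector_mult_scaleR
  have rec5_alt: "rec5 J = (- 1 / a) *\<^sub>R (x67 6 + b *\<^sub>R rec6 J)"
    using nz by (simp add: rec5_def a_def b_def minus_divide_left)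
  have c6: "J *v x67 6 = rec6 J"
    using assms by (simp add: adapted67_def rec6_def)
  have solve: "v = (- 1 / c) *\<^sub>R (x + w)" if "c *\<^sub>R v + w = - x" "c \<noteq> 0" for c :: real and v w x :: "real^6"
  proof -
    have "x + w = - (c *\<^sub>R v)" using that(1) by (simp add: algebra_simps eq_neg_iff_add_eq_0)
    then show ?thesis using that(2) by simp
  qed
  have "J *v rec6 J = - x67 6"
    using sq[of "x67 6"] c6 by simp
  then have "a *\<^sub>R (J *v x67 5) + b *\<^sub>R rec6 J = - x67 6"
    unfolding rec6_def[of J] a_def b_def by (simp only: lin c6[unfolded rec6_def])
  then have c5: "J *v x67 5 = rec5 J"
    using solve a rec5_alt by metis
  have c4: "J *v x67 4 = rec4 J"
    using J4 by (simp add: vec_eq_iff forall_6 rec4_components)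
  have "J *v rec4 J = - x67 4"
    using sq[of "x67 4"] c4 by simp
  then have "J$3$4 *\<^sub>R (J *v x67 3) + (J$4$4 *\<^sub>R rec4 J + J$5$4 *\<^sub>R rec5 J + J$6$4 *\<^sub>R rec6 J) = - x67 4"
    unfolding rec4_def[of J] by (simp only: lin c4[unfolded rec4_def] c5 c6 add.assoc)
  from solve[OF this nz(2)] have c3: "J *v x67 3 = rec3 J"
    by (simp add: rec3_def add.assoc)
  have c2: "J *v x67 2 = rec2 J"
    by (simp add: vec_eq_iff rec2_components)
  have "J *v rec2 J = - x67 2"
    using sq[of "x67 2"] c2 by simp
  then have "J$1$2 *\<^sub>R (J *v x67 1) + (J$2$2 *\<^sub>R rec2 J + J$3$2 *\<^sub>R rec3 J + J$4$2 *\<^sub>R rec4 J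
      + J$5$2 *\<^sub>R rec5 J + J$6$2 *\<^sub>R rec6 J) = - x67 2"
    unfolding rec2_def[of J] by (simp only: lin c2[unfolded rec2_def] c3 c4 c5 c6 add.assoc)
  from solve[OF this nz(1)] have c1: "J *v x67 1 = rec1 J"
    by (simp add: rec1_def add.assoc)
  show "recon67 J = J"
  proof (rule matrix_eq_axisI)
    have "recon67 J *v x67 j = J *v x67 j" if "j \<in> {1, 2, 3, 4, 5, 6}" for j
      using that c1 c2 c3 c4 c5 c6 unfolding recon67_def
      by (elim insertE emptyE) simp_all
    then show "recon67 J *v x67 j = J *v x67 j" for j
      using UNIV_6 by auto
  qed
qed

text \<open>Reconstruction copies the free entries and, by the next lemma, depends on nothing else.
  Its image is therefore a graph over the fixed space of \<open>param67\<close>.\<close>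

lemma param67_recon67: "param67 (recon67 M) = param67 M"
  by (simp add: param67_def recon67_def vec_eq_iff forall_6 rec2_components rec4_components)

lemma recon67_param67: "recon67 (param67 M) = recon67 M"
  by (simp add: recon67_def rec1_def rec2_def rec3_def rec4_def rec5_def rec6_def param67_def
      axis_component)

lemma param67_idem: "param67 (param67 M) = param67 M"
  by (simp add: param67_def vec_eq_iff forall_6 rec2_components rec4_components)

lemma param67_in_U67: "param67 M \<in> U67 \<longleftrightarrow> M \<in> U67"
  by (simp add: param67_def U67_def rec2_components rec4_components)

lemma linear_param67: "linear param67"
  by (rule linearI)
    (simp_all add: param67_def vec_eq_iff forall_6 rec2_components rec4_components)

lemma open_U67: "open U67"
  unfolding U67_def
  by (intro open_Collect_conj open_Collect_neq continuous_intros)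

lemma smooth_map_on_recon67: "smooth_map_on U67 recon67"
proof -
  have entry: "smooth_map_on U67 (\<lambda>M. M $ i $ j)" for i j
    by (intro smooth_map_on_bounded_linear open_U67 bounded_linear_intros
      bounded_linear_compose[OF bounded_linear_vec_nth bounded_linear_vec_nth])
  note smooth = smooth_map_on_add[OF open_U67] smooth_map_on_diff[OF open_U67] smooth_map_on_minus[OF open_U67]
    smooth_map_on_mult[OF open_U67] smooth_map_on_divide[OF open_U67] smooth_map_on_scaleR[OF open_U67]
    smooth_map_on_const entry
  have r6: "smooth_map_on U67 rec6"
    unfolding rec6_def[abs_def] by (intro smooth) (auto simp: U67_def)
  have r5: "smooth_map_on U67 rec5"
    unfolding rec5_def[abs_def] by (intro smooth r6) (auto simp: U67_def)
  have r4: "smooth_map_on U67 rec4"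
    unfolding rec4_def[abs_def] by (intro smooth)
  have r3: "smooth_map_on U67 rec3"
    unfolding rec3_def[abs_def] by (intro smooth r4 r5 r6) (auto simp: U67_def)
  have r2: "smooth_map_on U67 rec2"
    unfolding rec2_def[abs_def] by (intro smooth)
  have r1: "smooth_map_on U67 rec1"
    unfolding rec1_def[abs_def] by (intro smooth r2 r3 r4 r5 r6) (auto simp: U67_def)
  have comp: "smooth_map_on U67 (\<lambda>M. f M $ i)" if "smooth_map_on U67 f" for f :: "real^6^6 \<Rightarrow> real^6" and i
    by (rule smooth_map_on_compose_linear[OF open_U67 bounded_linear_vec_nth that])
  have "smooth_map_on U67 (\<lambda>M. recon67 M $ i $ j)" if "j \<in> {1, 2, 3, 4, 5, 6}" for i j
    using that unfolding recon67_def
    by (elim insertE emptyE) (simp_all add: comp r1 r2 r3 r4 r5 r6)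
  then have "smooth_map_on U67 (\<lambda>M. recon67 M $ i $ j)" for i j
    using UNIV_6 by auto
  then show ?thesis
    by (intro smooth_map_on_vec open_U67)
qed

section \<open>Dimension of the parameter space and the slice chart\<close>

lemma dim_param67: "dim {N. param67 N = N} = 10"
proof -
  \<comment> \<open>The positions (row, column) of the free entries: all of column 2, and rows 3 to
    6 of column 4. The fixed space is spanned by the matrix units at these positions.\<close>
  define I :: "(6 \<times> 6) set"
    where "I = {(1,2), (2,2), (3,2), (4,2), (5,2), (6,2), (3,4), (4,4), (5,4), (6,4)}"
  define e :: "6 \<times> 6 \<Rightarrow> real^6^6" where "e = (\<lambda>(i, j). axis i (axis j 1))"
  have "inj e"
    by (auto simp: e_def inj_def axis_eq_axis)
  have Basis: "(Basis :: (real^6^6) set) = range e"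
    by (auto simp: e_def Basis_vec_def)
  have "param67 N = N \<longleftrightarrow> (\<forall>b\<in>Basis. b \<notin> e ` I \<longrightarrow> N \<bullet> b = 0)" for N
  proof -
    have "param67 N = N \<longleftrightarrow> (\<forall>i j. (i, j) \<notin> I \<longrightarrow> N $ i $ j = 0)"
      by (auto simp: I_def vec_eq_iff forall_6 param67_def rec2_components rec4_components)
    also have "\<dots> \<longleftrightarrow> (\<forall>ij. ij \<notin> I \<longrightarrow> N \<bullet> e ij = 0)"
      by (simp add: e_def inner_axis split_paired_all)
    finally show ?thesis
      by (simp add: Basis inj_image_mem_iff[OF \<open>inj e\<close>])
  qed
  moreover have "e ` I \<subseteq> Basis"
    by (auto simp: Basis)
  ultimately have "dim {N. param67 N = N} = card (e ` I)"
    by (simp only: dim_substandard)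
  also have "\<dots> = card I"
    by (intro card_image inj_on_subset[OF \<open>inj e\<close>]) simp
  finally show ?thesis by (simp add: I_def)
qed

text \<open>A single shear of \<open>U67\<close> straightens the graph and serves as slice chart at
  every point. Both \<open>\<phi>\<close> and \<open>\<psi>\<close> preserve the free entries, hence
  also the value of \<open>recon67\<close>, so adding the graph map undoes subtracting it.\<close>

lemma smooth_submanifold_complex_structures_67:
  "smooth_submanifold 10 (complex_structures bracket67)"
proof -
  \<comment> \<open>subtracts the graph map, which is \<open>recon67 - param67\<close>\<close>
  define \<phi> where "\<phi> = (\<lambda>M. M - recon67 M + param67 M)"
  define \<psi> where "\<psi> = (\<lambda>N. N + recon67 N - param67 N)"
  let ?L = "{N. param67 N = N}"
  note lin = linear_add[OF linear_param67] linear_diff[OF linear_param67]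
  have par: "param67 (\<phi> M) = param67 M" "param67 (\<psi> M) = param67 M" for M
    by (simp_all add: \<phi>_def \<psi>_def lin param67_recon67 param67_idem)
  then have rec: "recon67 (\<phi> M) = recon67 M" "recon67 (\<psi> M) = recon67 M" for M
    by (metis recon67_param67)+
  have U: "\<phi> M \<in> U67 \<longleftrightarrow> M \<in> U67" "\<psi> M \<in> U67 \<longleftrightarrow> M \<in> U67" for M
    by (metis par param67_in_U67)+
  have inv: "\<psi> (\<phi> M) = M" "\<phi> (\<psi> M) = M" for M
    using par[of M] rec[of M] by (simp_all add: \<phi>_def \<psi>_def)
  note smooth = smooth_map_on_add[OF open_U67] smooth_map_on_diff[OF open_U67] smooth_map_on_recon67
    smooth_map_on_bounded_linear[OF open_U67 bounded_linear_ident]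
    smooth_map_on_bounded_linear[OF open_U67 linear_param67[unfolded linear_conv_bounded_linear]]
  have smooth_\<phi>: "smooth_map_on U67 \<phi>" and smooth_\<psi>: "smooth_map_on U67 \<psi>"
    unfolding \<phi>_def \<psi>_def by (intro smooth)+
  have cont: "continuous_on U67 f" if "smooth_map_on U67 f" for f :: "real^6^6 \<Rightarrow> real^6^6"
    using that Ck_on.simps(1) unfolding smooth_map_on_def by blast
  have "homeomorphism U67 U67 \<phi> \<psi>"
    using cont[OF smooth_\<phi>] cont[OF smooth_\<psi>] U inv by (intro homeomorphismI) auto
  then have diffeo: "diffeomorphism_between U67 U67 \<phi> \<psi>"
    by (simp add: diffeomorphism_between_def open_U67 smooth_\<phi> smooth_\<psi>)
  have "\<phi> ` (complex_structures bracket67 \<inter> U67) = ?L \<inter> U67"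
  proof (intro equalityI subsetI)
    fix N assume "N \<in> \<phi> ` (complex_structures bracket67 \<inter> U67)"
    then obtain J where J: "adapted67 J" "J \<in> U67" "N = \<phi> J"
      by (auto simp: complex_structures_iff_adapted67)
    then have "N = param67 J" by (simp add: \<phi>_def recon67_adapted67)
    then show "N \<in> ?L \<inter> U67" using J by (simp add: param67_idem param67_in_U67)
  next
    fix N assume N: "N \<in> ?L \<inter> U67"
    then have "\<psi> N = recon67 N" by (simp add: \<psi>_def)
    moreover have "adapted67 (recon67 N)"
      using N by (intro adapted67_recon67) simp
    ultimately have "\<psi> N \<in> complex_structures bracket67 \<inter> U67"
      by (simp add: complex_structures_iff_adapted67 recon67_adapted67(2))
    then show "N \<in> \<phi> ` (complex_structures bracket67 \<inter> U67)"
      by (rule image_eqI[where f=\<phi>, OF inv(2)[of N, symmetric]])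
  qed
  moreover have "subspace ?L"
    by (rule subspaceI) (simp_all add: lin linear_0[OF linear_param67] linear_scale[OF linear_param67])
  moreover have "complex_structures bracket67 \<subseteq> U67"
    using complex_structures_iff_adapted67 recon67_adapted67(2) by blast
  ultimately show ?thesis
    unfolding smooth_submanifold_def using diffeo dim_param67
    by (intro ballI exI[of _ U67] exI[of _ \<phi>] exI[of _ \<psi>] exI[of _ ?L]) (simp add: subset_eq)
qed

theorem mainTheorem2:
  shows
    "(\<forall>J\<in>complex_structures bracket67.
        \<exists>\<alpha>::real. \<alpha> \<noteq> 0 \<and> \<alpha> \<noteq> 1 \<and> equivalent_structures bracket67 J (J67 \<alpha>)) \<and>
     (\<forall>\<alpha> \<alpha>'. \<alpha> \<noteq> 0 \<and> \<alpha> \<noteq> 1 \<and> \<alpha>' \<noteq> 0 \<and> \<alpha>' \<noteq> 1 \<and> \<alpha> \<noteq> \<alpha>' \<longrightarrow>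
        \<not> equivalent_structures bracket67 (J67 \<alpha>) (J67 \<alpha>')) \<and>
     smooth_submanifold 10 (complex_structures bracket67) \<and>
     complex_structures bracket67 = (\<Union>\<alpha>\<in>UNIV - {0, 1}. aut_orbit bracket67 (J67 \<alpha>)) \<and>
     disjoint_family_on (\<lambda>\<alpha>. aut_orbit bracket67 (J67 \<alpha>)) (UNIV - {0, 1})"
proof (intro conjI)
  show "\<forall>J\<in>complex_structures bracket67.
      \<exists>\<alpha>::real. \<alpha> \<noteq> 0 \<and> \<alpha> \<noteq> 1 \<and> equivalent_structures bracket67 J (J67 \<alpha>)"
  proof
    fix J assume "J \<in> complex_structures bracket67"
    then obtain \<alpha> where "\<alpha> \<noteq> 0" "\<alpha> \<noteq> 1" "J \<in> aut_orbit bracket67 (J67 \<alpha>)"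
      by (auto simp: complex_structures_67_eq)
    \<comment> \<open>The common base point required by \<open>equivalent_structures\<close> is
      \<open>J67 \<alpha>\<close> itself.\<close>
    then show "\<exists>\<alpha>. \<alpha> \<noteq> 0 \<and> \<alpha> \<noteq> 1 \<and> equivalent_structures bracket67 J (J67 \<alpha>)"
      using J67_complex_structure aut_orbit_refl unfolding equivalent_structures_def by blast
  qed
  show "\<forall>\<alpha> \<alpha>'. \<alpha> \<noteq> 0 \<and> \<alpha> \<noteq> 1 \<and> \<alpha>' \<noteq> 0 \<and> \<alpha>' \<noteq> 1 \<and> \<alpha> \<noteq> \<alpha>' \<longrightarrow>
      \<not> equivalent_structures bracket67 (J67 \<alpha>) (J67 \<alpha>')"
    using equivalent_J67_imp_eq by blast
  show "disjoint_family_on (\<lambda>\<alpha>. aut_orbit bracket67 (J67 \<alpha>)) (UNIV - {0, 1})"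
  proof (unfold disjoint_family_on_def, intro ballI impI equals0I)
    fix \<alpha> \<beta> :: real and J
    assume "\<alpha> \<in> UNIV - {0, 1}" "\<beta> \<in> UNIV - {0, 1}" "\<alpha> \<noteq> \<beta>"
      and J: "J \<in> aut_orbit bracket67 (J67 \<alpha>) \<inter> aut_orbit bracket67 (J67 \<beta>)"
    moreover have "J67 \<alpha> \<in> aut_orbit bracket67 (J67 \<beta>)"
      using J aut_orbit_trans[OF aut_orbit_sym] by blast
    ultimately show False
      using J67_equivalent_imp_eq by simp
  qed
qed (rule smooth_submanifold_complex_structures_67 complex_structures_67_eq)+

end
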